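(* Let $d\ge1$ and $s<\frac{d}{2(d+1)}$. Then the maximal estimate $$\Big\|\sup_{0\le t\le1}|e^{it\Delta}f(x)|\Big\|_{L^2_x(\mathbb{T}^d)}\le C\,\|f\|_{H^s(\mathbb{T}^d)}$$ fails, i.e. there is no constant $C<\infty$ for which it holds for all $f$.
   Context: $\mathbb{T}=\mathbb{R}/2\pi\mathbb{Z}$; $e^{it\Delta}f(x)=\sum_{n\in\mathbb{Z}^d}\widehat f(n)e^{in\cdot x-it|n|^2}$. The estimate is understood as an a priori estimate for trigonometric polynomials $f$ (for which all pointwise values are defined) with a constant $C$ independent of $f$. *)

theory Defs
  imports "HOL-Analysis.Analysis"
begin

text \<open>
  Functions on the torus of dimension \<open>d = CARD('n)\<close> are functions on \<open>real ^ 'n\<close> that are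
  \<open>2 * pi\<close>-periodic in each coordinate, integrated over the period cube with (unnormalised)
  Lebesgue measure.
\<close>

definition period_cube :: "(real ^ 'n::finite) set" where
  "period_cube = cbox 0 (\<chi> j. 2 * pi)"

definition freq :: "int ^ 'n::finite \<Rightarrow> real ^ 'n" where
  "freq k = (\<chi> j. of_int (k $ j))"

definition trig_polynomial :: "(real ^ 'n::finite \<Rightarrow> complex) \<Rightarrow> bool" where
  "trig_polynomial f \<longleftrightarrow>
     (\<exists>K a. finite K \<and> f = (\<lambda>x. \<Sum>k\<in>K. a k * cis (freq k \<bullet> x)))"

definition fourier_coeff :: "(real ^ 'n::finite \<Rightarrow> complex) \<Rightarrow> int ^ 'n \<Rightarrow> complex" where
  "fourier_coeff f k =
     (LINT x:period_cube|lborel. f x * cis (- (freq k \<bullet> x))) / of_real ((2 * pi) ^ CARD('n))"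

text \<open>
  The two infinite sums below are meant for functions with finitely many nonzero Fourier
  coefficients; \<open>infsum\<close> is \<open>0\<close> on families that are not summable.
\<close>

definition schroedinger_flow ::
    "real \<Rightarrow> (real ^ 'n::finite \<Rightarrow> complex) \<Rightarrow> real ^ 'n \<Rightarrow> complex" where
  "schroedinger_flow t f x =
     (\<Sum>\<^sub>\<infinity>k. fourier_coeff f k * cis (freq k \<bullet> x - t * (norm (freq k))\<^sup>2))"

definition sobolev_norm :: "real \<Rightarrow> (real ^ 'n::finite \<Rightarrow> complex) \<Rightarrow> real" where
  "sobolev_norm s f =
     sqrt (\<Sum>\<^sub>\<infinity>k. (1 + (norm (freq k))\<^sup>2) powr s * (cmod (fourier_coeff f k))\<^sup>2)"

definition torus_L2_norm :: "(real ^ 'n::finite \<Rightarrow> real) \<Rightarrow> real" where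
  "torus_L2_norm g = sqrt (LINT x:period_cube|lborel. (g x)\<^sup>2)"

end

theory Submission
  imports Defs
begin

text \<open>
  Take \<open>f(x) = (\<Sum>k<N. exp(i k x\<^sub>1)) \<dots> (\<Sum>k<N. exp(i k x\<^sub>d))\<close>, for which the flow factorises into
  one-dimensional quadratic exponential sums. If \<open>x\<close> lies within \<open>O(1/N)\<close> of \<open>pi * b / q\<close>, then at
  time \<open>t = pi / (2 * q)\<close> each factor is a perturbed Gauss sum to the even modulus \<open>2 * q\<close> and has
  size about \<open>N / sqrt q\<close>, whatever the residues \<open>b\<close> are. By Dirichlet's theorem on simultaneous
  approximation every \<open>x\<close> is that close for some \<open>q \<le> Q\<close> with \<open>Q\<close> of order \<open>N powr (d / (d + 1))\<close>,
  unless \<open>q\<close> is much smaller than \<open>Q\<close>, which happens on at most half of the torus. So the maximal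
  function is at least about \<open>(N / sqrt Q) ^ d\<close> on a set of positive proportion, which exceeds the
  \<open>L\<^sup>2\<close> norm \<open>N powr (d / 2)\<close> of \<open>f\<close> by the factor \<open>N powr (d / (2 * (d + 1)))\<close>. At the regularity \<open>s\<close>
  the Sobolev norm gains only \<open>N powr s\<close> over the \<open>L\<^sup>2\<close> norm.
\<close>

subsection \<open>Gauss sums\<close>

text \<open>A weak Jordan inequality. Up to \<open>pi / 6\<close> the mean value theorem applies
  with a cosine of at least \<open>1 / 2\<close>; beyond that,
  \<open>sin x \<ge> 1 / 2 \<ge> x / pi\<close>.\<close>

lemma sin_ge_div_pi:
  fixes x :: real
  assumes "0 \<le> x" "x \<le> pi / 2"
  shows "x / pi \<le> sin x"
proof (cases "x \<le> pi / 6")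
  case True
  have "\<exists>z. 0 \<le> z \<and> z \<le> x \<and> sin x - sin 0 = (x - 0) * cos z"
  proof (cases "x = 0")
    case False
    with assms have "0 < x" by simp
    from MVT2[OF this DERIV_sin] show ?thesis
      by (meson less_imp_le)
  qed auto
  then obtain z where z: "0 \<le> z" "z \<le> x" "sin x = x * cos z"
    by auto
  have "cos (pi / 3) \<le> cos z"
    using z True pi_gt_zero by (intro cos_monotone_0_pi_le) linarith+
  hence "x * (1 / 2) \<le> sin x"
    using z assms mult_left_mono[of "1 / 2" "cos z" x] by (simp add: cos_60)
  moreover have "x / pi \<le> x / 2"
    using assms pi_gt3 by (intro divide_left_mono) auto
  ultimately show ?thesis by linarith
next
  case False
  have "sin (pi / 6) \<le> sin x"
    using assms False pi_gt_zero by (intro sin_monotone_2pi_le) linarith+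
  moreover have "x / pi \<le> 1 / 2"
    using assms by (simp add: field_simps)
  ultimately show ?thesis unfolding sin_30 by linarith
qed

lemma norm_sum_cis_le:
  assumes "sin (\<theta> / 2) \<noteq> 0"
  shows "cmod (\<Sum>k<n. cis (real k * \<theta>)) \<le> 1 / \<bar>sin (\<theta> / 2)\<bar>"
proof -
  have d: "cmod (cis t - 1) = 2 * \<bar>sin (t / 2)\<bar>" for t
    using dist_exp_i_1[of t] by (simp add: cis_conv_exp)
  have ne: "cis \<theta> \<noteq> 1"
    using d[of \<theta>] assms by auto
  have "(\<Sum>k<n. cis (real k * \<theta>)) = (\<Sum>k<n. cis \<theta> ^ k)"
    by (intro sum.cong refl) (simp only: Complex.DeMoivre)
  also have "\<dots> = (cis (real n * \<theta>) - 1) / (cis \<theta> - 1)"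
    unfolding geometric_sum[OF ne] by (simp only: Complex.DeMoivre)
  also have "cmod \<dots> = \<bar>sin (real n * \<theta> / 2)\<bar> / \<bar>sin (\<theta> / 2)\<bar>"
    by (simp add: norm_divide d)
  also have "\<dots> \<le> 1 / \<bar>sin (\<theta> / 2)\<bar>"
    by (intro divide_right_mono) auto
  finally show ?thesis .
qed

text \<open>Orthogonality of the additive characters modulo \<open>p\<close>: for a nontrivial
  character the sum is geometric with a ratio \<open>z \<noteq> 1\<close> satisfying
  \<open>z ^ p = 1\<close>.\<close>

lemma sum_cis_root_of_unity:
  fixes h :: int
  assumes "p > 0"
  shows "(\<Sum>k<p. cis (2 * pi * real_of_int h * real k / real p)) = (if int p dvd h then of_nat p else 0)"
proof (cases "int p dvd h")
  case True
  then obtain m where "h = int p * m" by auto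
  hence "cis (2 * pi * real_of_int h * real k / real p) = 1" for k
    using assms cis_multiple_2pi[of "real_of_int (m * int k)"]
    by (simp add: mult_ac)
  thus ?thesis using True by simp
next
  case False
  define z where "z = cis (2 * pi * (real_of_int h / real p))"
  have "z \<noteq> 1"
  proof
    assume "z = 1"
    hence "cos (2 * pi * (real_of_int h / real p)) = 1"
      by (simp add: z_def complex_eq_iff)
    then obtain m :: int where "2 * pi * (real_of_int h / real p) = real_of_int m * 2 * pi"
      by (auto simp: cos_one_2pi_int)
    hence "real_of_int h = real_of_int (m * int p)"
      using assms by (simp add: field_simps)
    hence "h = m * int p" by (simp only: of_int_eq_iff)
    with False show False by simp
  qed
  have "z ^ p = cis (real p * (2 * pi * (real_of_int h / real p)))"
    unfolding z_def by (rule Complex.DeMoivre)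
  also have "\<dots> = cis (2 * pi * real_of_int h)"
    using assms by simp
  also have "\<dots> = 1" by simp
  finally have "z ^ p = 1" .
  have "(\<Sum>k<p. cis (2 * pi * real_of_int h * real k / real p)) = (\<Sum>k<p. z ^ k)"
    by (simp add: z_def Complex.DeMoivre mult_ac)
  also have "\<dots> = 0"
    using \<open>z \<noteq> 1\<close> \<open>z ^ p = 1\<close> by (simp add: geometric_sum)
  finally show ?thesis using False by simp
qed

lemma sum_periodic_shift:
  fixes c :: "nat \<Rightarrow> 'a :: ab_group_add"
  assumes "\<And>k. c (k + p) = c k"
  shows "(\<Sum>k<p. c (k + l)) = (\<Sum>k<p. c k)"
proof (induction l)
  case (Suc l)
  have "(\<Sum>k<p. c (k + Suc l)) - (\<Sum>k<p. c (k + l)) = (\<Sum>k<p. c (Suc k + l) - c (k + l))"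
    by (simp add: sum_subtractf)
  also have "\<dots> = c (p + l) - c l"
    using sum_lessThan_telescope[of "\<lambda>k. c (k + l)" p] by simp
  also have "\<dots> = 0"
    using assms[of l] by (simp add: add.commute)
  finally show ?case using Suc by simp
qed simp

text \<open>The quadratic phase is \<open>pi * k^2 / p\<close>, half of the usual one, so a shift of
  \<open>k\<close> by \<open>p\<close> multiplies the term by \<open>(-1) ^ p\<close>. Hence the
  moduli below are even.\<close>

definition gauss_term :: "nat \<Rightarrow> int \<Rightarrow> nat \<Rightarrow> complex" where
  "gauss_term p b k = cis (2 * pi * real_of_int b * real k / real p - pi * (real k)\<^sup>2 / real p)"

text \<open>The cross term \<open>2 * h * l\<close> of the square turns into an additive character
  in \<open>l\<close>, to which orthogonality applies.\<close>

lemma gauss_term_add: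
  assumes "p > 0"
  shows "gauss_term p b (h + l) = gauss_term p b h * gauss_term p b l * cis (2 * pi * real_of_int (- int h) * real l / real p)"
  using assms unfolding gauss_term_def cis_mult
  by (intro arg_cong[where f = cis]) (simp add: field_simps power2_eq_square)

lemma gauss_term_periodic:
  assumes "p > 0" "even p"
  shows "gauss_term p b (k + p) = gauss_term p b k"
proof -
  obtain r where r: "p = 2 * r" using assms by auto
  have "gauss_term p b p = cis (2 * pi * real_of_int (b - int r))"
    using assms(1) r unfolding gauss_term_def
    by (intro arg_cong[where f = cis]) (simp add: field_simps power2_eq_square)
  hence 1: "gauss_term p b p = 1" by (simp only: cis_multiple_2pi Ints_of_int)
  have "cis (2 * pi * real_of_int (- int k) * real p / real p) = cis (2 * pi * real_of_int (- int k))"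
    using assms by simp
  also have "\<dots> = 1" by (simp only: cis_multiple_2pi Ints_of_int)
  finally show ?thesis
    using gauss_term_add[OF assms(1), of b k p] 1 by simp
qed

text \<open>Weyl differencing: the squared modulus is a double sum over \<open>l\<close> and the
  difference \<open>h\<close>. For fixed \<open>h\<close> the sum over \<open>l\<close> is a
  character sum, which vanishes unless \<open>h = 0\<close>; that term contributes
  \<open>p\<close>.\<close>

lemma norm_gauss_sum:
  assumes "p > 0" "even p"
  shows "cmod (\<Sum>k<p. gauss_term p b k) = sqrt (real p)"
proof -
  let ?c = "gauss_term p b"
  have unit: "?c k * cnj (?c k) = 1" for k
    by (simp add: gauss_term_def complex_norm_square[symmetric])
  have "of_real ((cmod (\<Sum>k<p. ?c k))\<^sup>2) = (\<Sum>l<p. cnj (?c l) * (\<Sum>k<p. ?c k))"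
    by (simp only: complex_norm_square cnj_sum sum_distrib_right[symmetric] mult.commute)
  \<comment> \<open>By periodicity the inner sum may start at \<open>l\<close>, so that
    \<open>h\<close> becomes the difference of the two indices.\<close>
  also have "\<dots> = (\<Sum>l<p. \<Sum>h<p. cnj (?c l) * ?c (h + l))"
    using sum_periodic_shift[of ?c p, OF gauss_term_periodic[OF assms]]
    by (simp add: sum_distrib_left[symmetric])
  also have "\<dots> = (\<Sum>l<p. \<Sum>h<p. ?c h * cis (2 * pi * real_of_int (- int h) * real l / real p))"
    using unit by (intro sum.cong refl) (simp add: gauss_term_add[OF assms(1)] mult_ac)
  also have "\<dots> = (\<Sum>h<p. ?c h * (\<Sum>l<p. cis (2 * pi * real_of_int (- int h) * real l / real p)))"
    by (subst sum.swap) (simp add: sum_distrib_left)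
  also have "\<dots> = (\<Sum>h<p. if h = 0 then of_nat p else 0)"
  proof (intro sum.cong refl)
    fix h assume "h \<in> {..<p}"
    hence "int p dvd - int h \<longleftrightarrow> h = 0"
      by (auto dest: dvd_imp_le)
    thus "?c h * (\<Sum>l<p. cis (2 * pi * real_of_int (- int h) * real l / real p)) = (if h = 0 then of_nat p else 0)"
      by (simp only: sum_cis_root_of_unity[OF assms(1)]) (simp add: gauss_term_def)
  qed
  also have "\<dots> = of_nat p" using assms by simp
  finally have "(cmod (\<Sum>k<p. ?c k))\<^sup>2 = real p"
    by (metis of_real_eq_iff of_real_of_nat_eq)
  thus ?thesis by (metis norm_ge_zero real_sqrt_abs abs_of_nonneg)
qed

section \<open>Incomplete Gauss sums with a small linear perturbation\<close>

lemma sum_inverse_two_sided: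
  "(\<Sum>j=1..<p. 1 / real j + 1 / real (p - j)) \<le> 2 * harm p"
proof -
  have "(\<Sum>j=1..<p. 1 / real (p - j)) = (\<Sum>j=1..<p. 1 / real j)"
    by (rule sum.reindex_bij_witness[of _ "\<lambda>j. p - j" "\<lambda>j. p - j"]) auto
  moreover have "(\<Sum>j=1..<p. 1 / real j) \<le> harm p"
    unfolding harm_def inverse_eq_divide by (intro sum_mono2) auto
  ultimately show ?thesis by (simp add: sum.distrib)
qed

text \<open>Since \<open>\<delta>\<close> is at most half the spacing \<open>1 / p\<close>, the
  frequency \<open>j / p + \<delta>\<close> keeps at least half of the distance of
  \<open>j / p\<close> to 0 and to 1. Adding the reciprocals of both distances avoids a minimum and
  is easy to sum over \<open>j\<close>.\<close>

lemma norm_sum_cis_off_zero_le: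
  fixes \<delta> :: real
  assumes "1 \<le> j" "j < p" "\<bar>\<delta>\<bar> \<le> 1 / (2 * real p)"
  shows "cmod (\<Sum>k<n. cis (real k * (2 * pi * (real j / real p + \<delta>)))) \<le> 2 * real p * (1 / real j + 1 / real (p - j))"
proof -
  define u where "u = real j / real p + \<delta>"
  have p: "real p > 0" "real (p - j) = real p - real j" using assms by auto
  have lo: "real j / (2 * real p) \<le> u"
  proof -
    have "1 / (2 * real p) \<le> real j / (2 * real p)" using assms by (intro divide_right_mono) auto
    thus ?thesis using assms p unfolding u_def by (auto simp: abs_le_iff field_simps)
  qed
  have hi: "real (p - j) / (2 * real p) \<le> 1 - u"
  proof -
    have "1 / (2 * real p) \<le> real (p - j) / (2 * real p)" using assms by (intro divide_right_mono) auto
    moreover have "real (p - j) / (2 * real p) + real (p - j) / (2 * real p) = 1 - real j / real p"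
      using p by (simp add: field_simps)
    ultimately show ?thesis using assms unfolding u_def by (simp add: abs_le_iff)
  qed
  have pos: "0 < real j / (2 * real p)" "0 < real (p - j) / (2 * real p)"
    using assms p by auto
  have main: "sin (pi * u) > 0 \<and> 1 / sin (pi * u) \<le> 2 * real p * (1 / real j + 1 / real (p - j))"
  proof (cases "u \<le> 1 / 2")
    case True
    have "pi * u / pi \<le> sin (pi * u)"
      using True lo pos by (intro sin_ge_div_pi) (auto simp: field_simps)
    hence s: "real j / (2 * real p) \<le> sin (pi * u)" using lo by simp
    hence "1 / sin (pi * u) \<le> 1 / (real j / (2 * real p))"
      using pos by (intro divide_left_mono mult_pos_pos) linarith+
    also have "\<dots> = 2 * real p * (1 / real j)" by simp
    also have "\<dots> \<le> 2 * real p * (1 / real j + 1 / real (p - j))"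
      by (intro mult_left_mono) auto
    finally show ?thesis using s pos by linarith
  next
    case False
    \<comment> \<open>Past the midpoint the reflection \<open>u\<close> to \<open>1 - u\<close>
      leaves the sine unchanged and brings the argument back into the range of
      \<open>sin_ge_div_pi\<close>.\<close>
    have "0 \<le> 1 - u" "1 - u \<le> 1 / 2" using False hi pos by linarith+
    hence "pi * (1 - u) / pi \<le> sin (pi * (1 - u))"
      by (intro sin_ge_div_pi) (auto simp: field_simps)
    moreover have "sin (pi * (1 - u)) = sin (pi * u)"
      by (simp add: right_diff_distrib)
    ultimately have s: "real (p - j) / (2 * real p) \<le> sin (pi * u)" using hi by simp
    hence "1 / sin (pi * u) \<le> 1 / (real (p - j) / (2 * real p))"
      using pos by (intro divide_left_mono mult_pos_pos) linarith+
    also have "\<dots> = 2 * real p * (1 / real (p - j))" by simp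
    also have "\<dots> \<le> 2 * real p * (1 / real j + 1 / real (p - j))"
      by (intro mult_left_mono) auto
    finally show ?thesis using s pos by linarith
  qed
  have e: "2 * pi * u / 2 = pi * u" by simp
  have "cmod (\<Sum>k<n. cis (real k * (2 * pi * u))) \<le> 1 / \<bar>sin (2 * pi * u / 2)\<bar>"
    using main unfolding e[symmetric] by (intro norm_sum_cis_le) auto
  also have "\<dots> \<le> 2 * real p * (1 / real j + 1 / real (p - j))"
    using main by (simp add: e)
  finally show ?thesis unfolding u_def .
qed

text \<open>All phases stay within \<open>pi / 3\<close> of 0, so every term has real part at least
  \<open>1 / 2\<close> and there is no cancellation.\<close>

lemma norm_sum_cis_near_zero_ge:
  fixes \<delta> :: real
  assumes "6 * real n * \<bar>\<delta>\<bar> \<le> 1"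
  shows "real n / 2 \<le> cmod (\<Sum>k<n. cis (real k * (2 * pi * \<delta>)))"
proof -
  have "1 / 2 \<le> Re (cis (real k * (2 * pi * \<delta>)))" if "k < n" for k
  proof -
    have "6 * (real k * \<bar>\<delta>\<bar>) \<le> 6 * (real n * \<bar>\<delta>\<bar>)"
      using that by (intro mult_left_mono mult_right_mono) auto
    hence "real k * \<bar>\<delta>\<bar> \<le> 1 / 6" using assms by linarith
    hence "2 * pi * (real k * \<bar>\<delta>\<bar>) \<le> 2 * pi * (1 / 6)" by (intro mult_left_mono) auto
    hence "\<bar>real k * (2 * pi * \<delta>)\<bar> \<le> pi / 3"
      by (simp add: abs_mult mult_ac)
    hence "cos (pi / 3) \<le> cos \<bar>real k * (2 * pi * \<delta>)\<bar>"
      by (intro cos_monotone_0_pi_le) auto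
    thus ?thesis by (simp add: cos_60)
  qed
  hence "(\<Sum>k<n. 1 / 2) \<le> (\<Sum>k<n. Re (cis (real k * (2 * pi * \<delta>))))"
    by (intro sum_mono) auto
  also have "\<dots> = Re (\<Sum>k<n. cis (real k * (2 * pi * \<delta>)))" by simp
  also have "\<dots> \<le> cmod (\<Sum>k<n. cis (real k * (2 * pi * \<delta>)))" by (rule complex_Re_le_cmod)
  finally show ?thesis by simp
qed

text \<open>
  The sum is completed: the discrete Fourier expansion of the Gauss terms modulo \<open>p\<close>, whose
  coefficients all have modulus \<open>1 / sqrt p\<close>, turns it into a combination of geometric sums,
  among which only the resonant one (\<open>j = 0\<close>) is large.
\<close>

lemma norm_incomplete_gauss_sum_ge:
  fixes \<delta> :: real
  assumes p: "p > 0" "even p" and \<delta>: "\<bar>\<delta>\<bar> \<le> 1 / (2 * real p)" "6 * real n * \<bar>\<delta>\<bar> \<le> 1"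
    and n: "16 * real p * harm p \<le> real n"
  shows "real n / (4 * sqrt (real p)) \<le> cmod (\<Sum>k<n. gauss_term p b k * cis (real k * (2 * pi * \<delta>)))"
proof -
  \<comment> \<open>\<open>\<Gamma> j\<close> is \<open>p\<close> times the discrete Fourier
    coefficient at frequency \<open>j\<close>. Twisting by a character only shifts \<open>b\<close>,
    so it is again a complete Gauss sum, of modulus \<open>sqrt p\<close>.\<close>
  define \<Gamma> where "\<Gamma> j = (\<Sum>r<p. gauss_term p (b - int j) r)" for j
  define E where "E j = (\<Sum>k<n. cis (real k * (2 * pi * (real j / real p + \<delta>))))" for j
  define S where "S = (\<Sum>k<n. gauss_term p b k * cis (real k * (2 * pi * \<delta>)))"
  have norm_\<Gamma>: "cmod (\<Gamma> j) = sqrt (real p)" for j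
    unfolding \<Gamma>_def by (rule norm_gauss_sum[OF p])
  \<comment> \<open>Fourier inversion modulo \<open>p\<close>; periodicity then extends it from
    residues to all \<open>k\<close>.\<close>
  have inv: "(\<Sum>j<p. \<Gamma> j * cis (2 * pi * real j * real k / real p)) = of_nat p * gauss_term p b k" for k
  proof -
    let ?g = "\<lambda>r. gauss_term p b r * (\<Sum>j<p. cis (2 * pi * real_of_int (int k - int r) * real j / real p))"
    have "(\<Sum>j<p. \<Gamma> j * cis (2 * pi * real j * real k / real p))
      = (\<Sum>j<p. \<Sum>r<p. gauss_term p b r * cis (2 * pi * real_of_int (int k - int r) * real j / real p))"
      unfolding \<Gamma>_def sum_distrib_right gauss_term_def cis_mult using p
      by (intro sum.cong refl arg_cong[where f = cis]) (simp add: field_simps)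
    also have "\<dots> = (\<Sum>r<p. ?g r)"
      by (subst sum.swap) (simp add: sum_distrib_left)
    also have "\<dots> = (\<Sum>r<p. if r = k mod p then of_nat p * gauss_term p b (k mod p) else 0)"
    proof (intro sum.cong refl)
      fix r assume "r \<in> {..<p}"
      hence "int p dvd int k - int r \<longleftrightarrow> r = k mod p"
        by (auto simp: mod_eq_dvd_iff[symmetric] simp flip: of_nat_mod)
      thus "?g r = (if r = k mod p then of_nat p * gauss_term p b (k mod p) else 0)"
        by (simp only: sum_cis_root_of_unity[OF p(1)]) simp
    qed
    also have "\<dots> = of_nat p * gauss_term p b (k mod p)" using p by simp
    also have "gauss_term p b (k mod p) = gauss_term p b k"
    proof -
      have "gauss_term p b (l + m * p) = gauss_term p b l" for l m
        by (induction m) (simp_all add: gauss_term_periodic[OF p] add.assoc[symmetric] add.commute[of p])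
      from this[of "k mod p" "k div p"] show ?thesis by simp
    qed
    finally show ?thesis .
  qed
  have "of_nat p * S = (\<Sum>k<n. \<Sum>j<p. \<Gamma> j * cis (2 * pi * real j * real k / real p) * cis (real k * (2 * pi * \<delta>)))"
    by (simp add: S_def sum_distrib_left mult.assoc[symmetric] inv[symmetric] sum_distrib_right)
  also have "\<dots> = (\<Sum>k<n. \<Sum>j<p. \<Gamma> j * cis (real k * (2 * pi * (real j / real p + \<delta>))))"
    unfolding mult.assoc cis_mult
    by (intro sum.cong refl arg_cong2[where f = "(*)"] arg_cong[where f = cis]) (simp add: field_simps)
  also have "\<dots> = (\<Sum>j<p. \<Gamma> j * E j)"
    by (subst sum.swap) (simp add: E_def sum_distrib_left)
  also have "{..<p} = insert 0 {1..<p}" using p by auto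
  also have "(\<Sum>j\<in>insert 0 {1..<p}. \<Gamma> j * E j) = \<Gamma> 0 * E 0 + (\<Sum>j=1..<p. \<Gamma> j * E j)"
    by (subst sum.insert) auto
  finally have eq: "of_nat p * S = \<Gamma> 0 * E 0 + (\<Sum>j=1..<p. \<Gamma> j * E j)" .
  have "cmod (\<Sum>j=1..<p. \<Gamma> j * E j) \<le> (\<Sum>j=1..<p. sqrt (real p) * (2 * real p * (1 / real j + 1 / real (p - j))))"
  proof (intro order_trans[OF norm_sum] sum_mono)
    fix j assume "j \<in> {1..<p}"
    hence "cmod (E j) \<le> 2 * real p * (1 / real j + 1 / real (p - j))"
      unfolding E_def using \<delta> by (intro norm_sum_cis_off_zero_le) auto
    thus "cmod (\<Gamma> j * E j) \<le> sqrt (real p) * (2 * real p * (1 / real j + 1 / real (p - j)))"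
      by (simp add: norm_mult norm_\<Gamma> mult_left_mono del: of_nat_diff)
  qed
  also have "\<dots> = sqrt (real p) * (2 * real p * (\<Sum>j=1..<p. 1 / real j + 1 / real (p - j)))"
    by (simp only: sum_distrib_left)
  also have "\<dots> \<le> sqrt (real p) * (2 * real p * (2 * harm p))"
    by (intro mult_left_mono sum_inverse_two_sided) auto
  \<comment> \<open>The constant 16 in the lower bound on \<open>n\<close> comes from here:
    \<open>4 * p * harm p\<close> has to be at most \<open>n / 4\<close>, half of what the resonant
    term guarantees.\<close>
  also have "\<dots> \<le> sqrt (real p) * (real n / 4)"
    using n by (intro mult_left_mono) auto
  finally have up: "cmod (\<Sum>j=1..<p. \<Gamma> j * E j) \<le> sqrt (real p) * (real n / 4)" .
  have "sqrt (real p) * (real n / 2) \<le> cmod (\<Gamma> 0 * E 0)"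
    using norm_sum_cis_near_zero_ge[OF \<delta>(2)]
    using mult_left_mono[of "real n / 2" "cmod (E 0)" "sqrt (real p)"]
    by (simp add: norm_mult norm_\<Gamma> E_def)
  also have "\<dots> \<le> cmod (of_nat p * S) + cmod (\<Sum>j=1..<p. \<Gamma> j * E j)"
    using norm_triangle_ineq4[of "of_nat p * S" "\<Sum>j=1..<p. \<Gamma> j * E j"] eq by simp
  finally have "sqrt (real p) * (real n / 4) \<le> real p * cmod S"
    using up by (simp add: norm_mult field_simps)
  hence "sqrt (real p) * (real n / 4) \<le> sqrt (real p) * (sqrt (real p) * cmod S)"
    by (simp add: mult.assoc[symmetric])
  hence "real n / 4 \<le> sqrt (real p) * cmod S" using p by simp
  thus ?thesis using p by (simp add: S_def field_simps)
qed

subsection \<open>Trigonometric polynomials on the torus\<close>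

text \<open>Fubini: \<open>lborel\<close> is the image of the product of one-dimensional Lebesgue
  measures under the map from coordinates to vectors.\<close>

lemma lborel_integral_prod_Basis:
  fixes f :: "'a::euclidean_space \<Rightarrow> real \<Rightarrow> 'b::{real_normed_field,banach,second_countable_topology}"
  assumes int: "\<And>b. b \<in> Basis \<Longrightarrow> integrable lborel (f b)"
  shows "(LINT x|lborel. (\<Prod>b\<in>Basis. f b (x \<bullet> b))) = (\<Prod>b\<in>Basis. (LINT y|lborel. f b y))"
proof -
  interpret product_sigma_finite "\<lambda>_. lborel :: real measure" ..
  have [measurable]: "f b \<in> borel_measurable borel" if "b \<in> Basis" for b
    using borel_measurable_integrable[OF int[OF that]] by simp
  have "(LINT x|lborel. (\<Prod>b\<in>Basis. f b (x \<bullet> b)))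
      = (LINT x|(\<Pi>\<^sub>M b\<in>Basis. lborel). (\<Prod>b\<in>Basis. f b ((\<Sum>c\<in>Basis. x c *\<^sub>R c) \<bullet> b)))"
    by (subst lborel_eq, subst integral_distr) simp_all
  also have "\<dots> = (LINT x|(\<Pi>\<^sub>M b\<in>Basis. lborel). (\<Prod>b\<in>Basis. f b (x b)))"
    by (intro Bochner_Integration.integral_cong refl prod.cong) simp
  also have "\<dots> = (\<Prod>b\<in>Basis. (LINT y|lborel. f b y))"
    by (rule product_integral_prod[OF finite_Basis int])
  finally show ?thesis .
qed

lemma Basis_cart_eq: "(Basis :: (real ^ 'n::finite) set) = range (\<lambda>j. axis j 1)"
  by (auto simp: Basis_vec_def)

lemma lborel_integral_prod_cart:
  fixes g :: "'n::finite \<Rightarrow> real \<Rightarrow> 'b::{real_normed_field,banach,second_countable_topology}"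
  assumes int: "\<And>j. integrable lborel (g j)"
  shows "(LINT x|lborel. (\<Prod>j\<in>UNIV. g j (x $ j))) = (\<Prod>j\<in>UNIV. (LINT y|lborel. g j y))"
proof -
  have inj: "inj (\<lambda>j::'n. axis j (1::real))"
    by (auto simp: inj_on_def axis_eq_axis)
  show ?thesis
    using lborel_integral_prod_Basis[of "\<lambda>b::real^'n. g (axis_index b)"] int
    by (simp add: Basis_cart_eq prod.reindex[OF inj] axis_index_axis inner_axis)
qed

lemma integral_cis_period:
  fixes m :: int
  shows "(LINT y:{0..2 * pi}|lborel. cis (of_int m * y)) = (if m = 0 then of_real (2 * pi) else 0)"
proof (cases "m = 0")
  case True
  thus ?thesis by (simp add: set_lebesgue_integral_def scaleR_conv_of_real)
next
  case False
  define F where "F y = cis (of_int m * y) / (\<i> * of_int m)" for y :: real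
  have "(F has_vector_derivative cis (of_int m * y)) (at y within S)" for y S
  proof -
    have "((\<lambda>y. cis (of_int m * y)) has_vector_derivative (of_int m *\<^sub>R (\<i> * cis (of_int m * y)))) (at y within S)"
      unfolding has_vector_derivative_def
      by (auto intro!: derivative_eq_intros simp: scaleR_conv_of_real)
    hence "((\<lambda>y. cis (of_int m * y) / (\<i> * of_int m)) has_vector_derivative (of_int m *\<^sub>R (\<i> * cis (of_int m * y))) / (\<i> * of_int m)) (at y within S)"
      by (rule has_vector_derivative_divide)
    thus ?thesis unfolding F_def using False by (simp add: scaleR_conv_of_real)
  qed
  hence "(LINT y|lborel. indicator {0..2 * pi} y *\<^sub>R cis (of_int m * y)) = F (2 * pi) - F 0"
    by (intro integral_FTC_Icc continuous_intros) auto
  also have "\<dots> = 0"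
    using cis_multiple_2pi[of "of_int m"] by (simp add: F_def mult_ac)
  finally show ?thesis using False by (simp add: set_lebesgue_integral_def)
qed

section \<open>Orthogonality of characters and Fourier coefficients\<close>

lemma freq_inner: "freq k \<bullet> x = (\<Sum>j\<in>UNIV. of_int (k $ j) * x $ j)"
  by (simp add: freq_def inner_vec_def)

lemma freq_diff: "freq (k - l) = freq k - freq l"
  by (simp add: freq_def vec_eq_iff)

lemma norm_freq_sq: "(norm (freq k))\<^sup>2 = (\<Sum>j\<in>UNIV. (of_int (k $ j))\<^sup>2)"
  unfolding power2_norm_eq_inner by (simp add: freq_def inner_vec_def power2_eq_square)

lemma cis_sum: "cis (sum f A) = (\<Prod>j\<in>A. cis (f j))"
  by (induction A rule: infinite_finite_induct) (simp_all add: cis_mult[symmetric])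

lemma mem_period_cube: "x \<in> period_cube \<longleftrightarrow> (\<forall>j. x $ j \<in> {0..2 * pi})"
  by (auto simp: period_cube_def mem_box_cart)

lemma integral_cis_period_cube:
  fixes m :: "int ^ 'n::finite"
  shows "(LINT x:period_cube|lborel. cis (freq m \<bullet> x)) = (if m = 0 then of_real ((2 * pi) ^ CARD('n)) else 0)"
proof -
  have "(LINT x:period_cube|lborel. cis (freq m \<bullet> x))
      = (LINT x|lborel. (\<Prod>j\<in>UNIV. indicator {0..2 * pi} (x $ j) *\<^sub>R cis (of_int (m $ j) * x $ j)))"
    unfolding set_lebesgue_integral_def
  proof (intro Bochner_Integration.integral_cong refl)
    fix x :: "real ^ 'n"
    show "indicator period_cube x *\<^sub>R cis (freq m \<bullet> x)
      = (\<Prod>j\<in>UNIV. indicator {0..2 * pi} (x $ j) *\<^sub>R cis (of_int (m $ j) * x $ j))"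
    proof (cases "x \<in> period_cube")
      case True
      thus ?thesis by (simp add: mem_period_cube freq_inner cis_sum)
    next
      case False
      then obtain j where "x $ j \<notin> {0..2 * pi}" by (auto simp: mem_period_cube)
      hence "indicator {0..2 * pi} (x $ j) *\<^sub>R cis (of_int (m $ j) * x $ j) = 0" by simp
      hence "(\<Prod>j\<in>UNIV. indicator {0..2 * pi} (x $ j) *\<^sub>R cis (of_int (m $ j) * x $ j)) = 0"
        by (intro prod_zero) auto
      with False show ?thesis by simp
    qed
  qed
  also have "\<dots> = (\<Prod>j\<in>UNIV. LINT y:{0..2 * pi}|lborel. cis (of_int (m $ j) * y))"
    unfolding set_lebesgue_integral_def
    by (intro lborel_integral_prod_cart borel_integrable_compact continuous_intros) auto
  also have "\<dots> = (\<Prod>j\<in>UNIV. if m $ j = 0 then of_real (2 * pi) else 0)"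
    by (simp only: integral_cis_period)
  also have "\<dots> = (if m = 0 then of_real ((2 * pi) ^ CARD('n)) else 0)"
  proof (cases "m = 0")
    case False
    then obtain j where "m $ j \<noteq> 0" by (auto simp: vec_eq_iff)
    thus ?thesis using False by (auto intro!: prod_zero)
  qed simp
  finally show ?thesis .
qed

lemma set_integrable_period_cube:
  fixes f :: "real ^ 'n::finite \<Rightarrow> 'b::{banach,second_countable_topology}"
  assumes "continuous_on UNIV f"
  shows "set_integrable lborel period_cube f"
  unfolding set_integrable_def period_cube_def
  by (intro borel_integrable_compact continuous_on_subset[OF assms]) auto

text \<open>Orthogonality of characters. It reduces the infinite sums defining the flow and the
  Sobolev norm to finite ones, so the default value of \<open>infsum\<close> does not
  interfere.\<close>

lemma fourier_coeff_trig_polynomial: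
  fixes a :: "int ^ 'n::finite \<Rightarrow> complex"
  assumes "finite K"
  shows "fourier_coeff (\<lambda>x. \<Sum>k\<in>K. a k * cis (freq k \<bullet> x)) m = (if m \<in> K then a m else 0)"
proof -
  have int: "set_integrable lborel period_cube (\<lambda>x. a k * cis (freq (k - m) \<bullet> x))" for k
    by (intro set_integrable_period_cube continuous_intros)
  have "(LINT x:period_cube|lborel. (\<Sum>k\<in>K. a k * cis (freq k \<bullet> x)) * cis (- (freq m \<bullet> x)))
      = (LINT x:period_cube|lborel. (\<Sum>k\<in>K. a k * cis (freq (k - m) \<bullet> x)))"
    by (simp add: sum_distrib_right mult.assoc cis_mult freq_diff inner_diff_left)
  also have "\<dots> = (\<Sum>k\<in>K. LINT x:period_cube|lborel. a k * cis (freq (k - m) \<bullet> x))"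
    using int unfolding set_lebesgue_integral_def set_integrable_def scaleR_sum_right
    by (intro Bochner_Integration.integral_sum)
  also have "\<dots> = (\<Sum>k\<in>K. if k = m then a k * of_real ((2 * pi) ^ CARD('n)) else 0)"
    by (intro sum.cong refl) (simp add: set_integral_mult_right integral_cis_period_cube del: of_real_power of_real_mult)
  also have "\<dots> = (if m \<in> K then a m * of_real ((2 * pi) ^ CARD('n)) else 0)"
    using assms by simp
  finally show ?thesis by (simp add: fourier_coeff_def)
qed

lemma schroedinger_flow_trig_polynomial:
  fixes a :: "int ^ 'n::finite \<Rightarrow> complex"
  assumes "finite K"
  shows "schroedinger_flow t (\<lambda>x. \<Sum>k\<in>K. a k * cis (freq k \<bullet> x)) x
       = (\<Sum>k\<in>K. a k * cis (freq k \<bullet> x - t * (norm (freq k))\<^sup>2))"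
  unfolding schroedinger_flow_def
  by (rule trans[OF infsum_cong_neutral infsum_finite[OF assms]])
    (auto simp: fourier_coeff_trig_polynomial[OF assms])

lemma sobolev_norm_trig_polynomial:
  fixes a :: "int ^ 'n::finite \<Rightarrow> complex"
  assumes "finite K"
  shows "sobolev_norm s (\<lambda>x. \<Sum>k\<in>K. a k * cis (freq k \<bullet> x))
       = sqrt (\<Sum>k\<in>K. (1 + (norm (freq k))\<^sup>2) powr s * (cmod (a k))\<^sup>2)"
  unfolding sobolev_norm_def
  by (intro arg_cong[where f = sqrt], rule trans[OF infsum_cong_neutral infsum_finite[OF assms]])
    (auto simp: fourier_coeff_trig_polynomial[OF assms])

section \<open>The test polynomial, its flow and its Sobolev norm\<close>

definition int_cube :: "nat \<Rightarrow> (int ^ 'n::finite) set" where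
  "int_cube N = {k. \<forall>j. 0 \<le> k $ j \<and> k $ j < int N}"

lemma bij_betw_int_cube:
  "bij_betw (\<lambda>g. \<chi> j. int (g j)) (PiE UNIV (\<lambda>_. {..<N})) (int_cube N :: (int ^ 'n::finite) set)"
proof (rule bij_betwI[where g = "\<lambda>k j. nat (k $ j)"])
  show "(\<lambda>g. \<chi> j. int (g j)) \<in> PiE UNIV (\<lambda>_. {..<N}) \<rightarrow> (int_cube N :: (int ^ 'n) set)"
    by (simp add: int_cube_def PiE_iff Pi_iff)
  show "(\<lambda>k j. nat (k $ j)) \<in> (int_cube N :: (int ^ 'n) set) \<rightarrow> PiE UNIV (\<lambda>_. {..<N})"
  proof
    fix k :: "int ^ 'n" assume k: "k \<in> int_cube N"
    have "nat (k $ j) < N" for j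
      using k[unfolded int_cube_def, simplified, rule_format, of j] by linarith
    thus "(\<lambda>j. nat (k $ j)) \<in> PiE UNIV (\<lambda>_. {..<N})" by (simp add: PiE_iff)
  qed
qed (simp_all add: int_cube_def vec_eq_iff)

lemma finite_int_cube: "finite (int_cube N :: (int ^ 'n::finite) set)"
  using bij_betw_finite[OF bij_betw_int_cube] by (metis finite_PiE finite finite_lessThan)

lemma sum_int_cube_prod:
  fixes h :: "'n::finite \<Rightarrow> int \<Rightarrow> 'b::comm_semiring_1"
  shows "(\<Sum>k\<in>int_cube N. \<Prod>j\<in>UNIV. h j (k $ j)) = (\<Prod>j\<in>UNIV. \<Sum>i<N. h j (int i))"
proof -
  have "(\<Sum>k\<in>int_cube N. \<Prod>j\<in>UNIV. h j (k $ j)) = (\<Sum>g\<in>PiE UNIV (\<lambda>_. {..<N}). \<Prod>j\<in>UNIV. h j (int (g j)))"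
    by (subst sum.reindex_bij_betw[OF bij_betw_int_cube, symmetric]) simp
  thus ?thesis by (simp add: prod_sum_PiE)
qed

lemma card_int_cube: "card (int_cube N :: (int ^ 'n::finite) set) = N ^ CARD('n)"
  using bij_betw_same_card[OF bij_betw_int_cube[where 'n = 'n, of N]] by (simp add: card_PiE)

text \<open>The factor \<open>1\<close> makes the lemmas on general trigonometric polynomials apply syntactically.\<close>

definition cube_poly :: "nat \<Rightarrow> real ^ 'n::finite \<Rightarrow> complex" where
  "cube_poly N x = (\<Sum>k\<in>int_cube N. 1 * cis (freq k \<bullet> x))"

lemma trig_polynomial_cube_poly: "trig_polynomial (cube_poly N)"
  unfolding trig_polynomial_def cube_poly_def[abs_def]
  by (rule exI[of _ "int_cube N"], rule exI[of _ "\<lambda>_. 1"]) (simp add: finite_int_cube)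

text \<open>Both \<open>freq k \<bullet> x\<close> and the squared norm of \<open>freq k\<close> are
  sums over coordinates, and the frequency set is a product; so the exponential sum
  factorises.\<close>

lemma schroedinger_flow_cube_poly:
  "schroedinger_flow t (cube_poly N) x = (\<Prod>j\<in>UNIV. \<Sum>k<N. cis (real k * x $ j - t * (real k)\<^sup>2))"
proof -
  have "schroedinger_flow t (cube_poly N) x = (\<Sum>k\<in>int_cube N. cis (freq k \<bullet> x - t * (norm (freq k))\<^sup>2))"
    unfolding cube_poly_def[abs_def] schroedinger_flow_trig_polynomial[OF finite_int_cube] by simp
  also have "\<dots> = (\<Sum>k\<in>int_cube N. \<Prod>j\<in>UNIV. cis (of_int (k $ j) * x $ j - t * (of_int (k $ j))\<^sup>2))"
    by (simp add: freq_inner norm_freq_sq sum_distrib_left sum_subtractf[symmetric] cis_sum)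
  also have "\<dots> = (\<Prod>j\<in>UNIV. \<Sum>k<N. cis (of_int (int k) * x $ j - t * (of_int (int k))\<^sup>2))"
    by (rule sum_int_cube_prod)
  finally show ?thesis by simp
qed

text \<open>The base of the weight is at least 1, so \<open>s\<close> may be raised to
  \<open>\<sigma>\<close>; a nonnegative exponent then lets the base be replaced by its largest
  possible size. This covers negative \<open>s\<close> too.\<close>

lemma sobolev_norm_cube_poly_le:
  assumes "s \<le> \<sigma>" "0 \<le> \<sigma>"
  shows "sobolev_norm s (cube_poly N :: real ^ 'n::finite \<Rightarrow> complex)
     \<le> sqrt (real N ^ CARD('n) * (1 + real CARD('n) * (real N)\<^sup>2) powr \<sigma>)"
proof -
  have "(1 + (norm (freq k))\<^sup>2) powr s \<le> (1 + real CARD('n) * (real N)\<^sup>2) powr \<sigma>"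
    if "k \<in> int_cube N" for k :: "int ^ 'n"
  proof -
    have "(norm (freq k))\<^sup>2 \<le> (\<Sum>j\<in>(UNIV::'n set). (real N)\<^sup>2)"
      unfolding norm_freq_sq
    proof (intro sum_mono power_mono)
      fix j show "real_of_int (k $ j) \<le> real N" "0 \<le> real_of_int (k $ j)"
        using that[unfolded int_cube_def, simplified, rule_format, of j] by auto
    qed
    hence le: "1 + (norm (freq k))\<^sup>2 \<le> 1 + real CARD('n) * (real N)\<^sup>2" by simp
    have "(1 + (norm (freq k))\<^sup>2) powr s \<le> (1 + (norm (freq k))\<^sup>2) powr \<sigma>"
      using assms by (intro powr_mono) auto
    also have "\<dots> \<le> (1 + real CARD('n) * (real N)\<^sup>2) powr \<sigma>"
      using assms le by (intro powr_mono2) auto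
    finally show ?thesis .
  qed
  hence "(\<Sum>k\<in>(int_cube N :: (int ^ 'n) set). (1 + (norm (freq k))\<^sup>2) powr s)
     \<le> real (card (int_cube N :: (int ^ 'n) set)) * (1 + real CARD('n) * (real N)\<^sup>2) powr \<sigma>"
    by (intro sum_bounded_above)
  thus ?thesis
    unfolding cube_poly_def[abs_def] sobolev_norm_trig_polynomial[OF finite_int_cube]
    by (simp add: card_int_cube)
qed

subsection \<open>Maximal functions and norms\<close>

text \<open>A supremum of continuous functions is lower semicontinuous: its strict superlevel sets
  are unions of open sets, hence open even for an uncountable index set such as the times in
  \<open>{0..1}\<close>.\<close>

lemma borel_measurable_SUP_continuous:
  fixes F :: "'i \<Rightarrow> 'a::topological_space \<Rightarrow> real"
  assumes "\<And>i. i \<in> I \<Longrightarrow> continuous_on UNIV (F i)" "\<And>x. bdd_above ((\<lambda>i. F i x) ` I)" "I \<noteq> {}"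
  shows "(\<lambda>x. SUP i\<in>I. F i x) \<in> borel_measurable borel"
proof (rule borel_measurableI_greater)
  fix y
  have "{x \<in> space borel. y < (SUP i\<in>I. F i x)} = (\<Union>i\<in>I. {x. y < F i x})"
    using assms by (auto simp: less_cSUP_iff)
  moreover have "open (\<Union>i\<in>I. {x. y < F i x})"
    using assms(1) by (intro open_UN ballI open_Collect_less continuous_on_const) auto
  ultimately show "{x \<in> space borel. y < (SUP i\<in>I. F i x)} \<in> sets borel"
    by simp
qed

text \<open>A Chebyshev-type bound. The uniform bound \<open>B\<close> secures integrability of the
  square, since a Bochner integral defaults to 0 otherwise.\<close>

lemma torus_L2_norm_ge:
  fixes F :: "real ^ 'n::finite \<Rightarrow> real"
  assumes [measurable]: "F \<in> borel_measurable borel" "S \<in> sets borel"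
    and S: "S \<subseteq> period_cube" "\<And>x. x \<in> S \<Longrightarrow> A \<le> F x" "0 \<le> A"
    and F: "\<And>x. \<bar>F x\<bar> \<le> B"
  shows "A * sqrt (measure lborel S) \<le> torus_L2_norm F"
proof -
  have cube [measurable]: "period_cube \<in> sets (borel :: (real ^ 'n) measure)"
    by (simp add: period_cube_def)
  have fin: "emeasure lborel (period_cube :: (real ^ 'n) set) < \<infinity>"
    unfolding period_cube_def by (rule emeasure_lborel_cbox_finite)
  have finS: "emeasure lborel S < \<infinity>"
    using emeasure_mono[OF S(1), of lborel] fin by (simp add: le_less_trans)
  have int: "integrable lborel (\<lambda>x. indicator period_cube x *\<^sub>R (F x)\<^sup>2)"
  proof (rule Bochner_Integration.integrable_bound)
    show "integrable lborel (\<lambda>x::real^'n. indicator period_cube x *\<^sub>R B\<^sup>2)"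
      using fin by simp
    have "(F x)\<^sup>2 \<le> B\<^sup>2" for x using F[of x] by (simp add: abs_le_square_iff[symmetric])
    thus "AE x in lborel. norm (indicator period_cube x *\<^sub>R (F x)\<^sup>2) \<le> norm (indicator period_cube x *\<^sub>R B\<^sup>2)"
      by (intro AE_I2) (simp add: indicator_def)
  qed simp
  have "A\<^sup>2 * measure lborel S = (LINT x|lborel. indicator S x *\<^sub>R A\<^sup>2)"
    using finS by simp
  also have "\<dots> \<le> (LINT x|lborel. indicator period_cube x *\<^sub>R (F x)\<^sup>2)"
  proof (rule integral_mono)
    show "integrable lborel (\<lambda>x. indicator S x *\<^sub>R A\<^sup>2)" using finS by simp
    show "indicator S x *\<^sub>R A\<^sup>2 \<le> indicator period_cube x *\<^sub>R (F x)\<^sup>2" for x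
      using S(1) power_mono[OF S(2,3), of x 2] by (auto simp: indicator_def)
  qed fact
  finally have "sqrt (A\<^sup>2 * measure lborel S) \<le> torus_L2_norm F"
    unfolding torus_L2_norm_def set_lebesgue_integral_def by simp
  thus ?thesis using S(3) by (simp add: real_sqrt_mult)
qed

subsection \<open>Simultaneous approximation\<close>

lemma Dirichlet_approx_simult_cart:
  fixes \<theta> :: "'n::finite \<Rightarrow> real"
  assumes "M > 0"
  obtains q b where "0 < q" "q \<le> M ^ CARD('n)"
    "\<And>j. \<bar>real q * \<theta> j - real_of_int (b j)\<bar> < 1 / real M"
proof -
  obtain h where h: "bij_betw h {0..<CARD('n)} (UNIV :: 'n set)"
    using ex_bij_betw_nat_finite[OF finite] by blast
  obtain q p where qp: "0 < q" "q \<le> int (M ^ CARD('n))"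
    "\<And>i. i < CARD('n) \<Longrightarrow> \<bar>of_int q * \<theta> (h i) - of_int (p i)\<bar> < 1 / M"
    using Dirichlet_approx_simult[OF assms, of "CARD('n)" "\<lambda>i. \<theta> (h i)"] by blast
  show thesis
  proof (rule that[of "nat q" "\<lambda>j. p (inv_into {0..<CARD('n)} h j)"])
    show "\<bar>real (nat q) * \<theta> j - real_of_int (p (inv_into {0..<CARD('n)} h j))\<bar> < 1 / real M" for j
    proof -
      have "j \<in> h ` {0..<CARD('n)}" using h by (simp add: bij_betw_def)
      hence "inv_into {0..<CARD('n)} h j < CARD('n)" "h (inv_into {0..<CARD('n)} h j) = j"
        using inv_into_into[of j h "{0..<CARD('n)}"] by (auto simp: f_inv_into_f)
      thus ?thesis using qp(3)[of "inv_into {0..<CARD('n)} h j"] qp(1) by simp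
    qed
  qed (use qp in \<open>auto simp: nat_le_iff\<close>)
qed

text \<open>
  Boxes of half side \<open>pi * r / q\<close> around the points \<open>pi * b / q\<close> that lie in the period cube.
  The step is \<open>pi / q\<close> rather than \<open>2 * pi / q\<close> because the Gauss sums are taken modulo \<open>2 * q\<close>.
\<close>

definition near_rational :: "nat \<Rightarrow> real \<Rightarrow> (real ^ 'n::finite) set" where
  "near_rational q r = (\<Union>b\<in>int_cube (2 * q + 1).
     box (\<chi> j. pi * (of_int (b $ j) - r) / real q) (\<chi> j. pi * (of_int (b $ j) + r) / real q))"

lemma near_rational_borel: "near_rational q r \<in> sets borel"
  unfolding near_rational_def by (intro borel_open open_UN ballI open_box)

lemma measure_lborel_box_cart:
  fixes l u :: "real ^ 'n::finite"
  assumes "\<And>j. l $ j \<le> u $ j"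
  shows "measure lborel (box l u) = (\<Prod>j\<in>UNIV. u $ j - l $ j)"
proof -
  have inj: "inj (\<lambda>j::'n. axis j (1::real))"
    by (auto simp: inj_on_def axis_eq_axis)
  show ?thesis using assms
    by (subst measure_lborel_box) (auto simp: Basis_cart_eq prod.reindex[OF inj] inner_axis)
qed

text \<open>There are \<open>2 * q + 1 \<le> 3 * q\<close> boxes per coordinate, each of side
  \<open>2 * pi * r / q\<close>; the factor \<open>q\<close> cancels, so the bound is uniform in the
  denominator.\<close>

lemma measure_near_rational_le:
  assumes "q > 0" "0 \<le> r"
  shows "measure lborel (near_rational q r :: (real ^ 'n::finite) set) \<le> (6 * pi * r) ^ CARD('n)"
proof -
  have box: "measure lborel (box (\<chi> j. pi * (of_int (b $ j) - r) / real q) (\<chi> j. pi * (of_int (b $ j) + r) / real q) :: (real ^ 'n) set)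
      = (2 * pi * r / real q) ^ CARD('n)" for b :: "int ^ 'n"
    using assms by (subst measure_lborel_box_cart)
      (auto simp: divide_right_mono diff_divide_distrib[symmetric] algebra_simps)
  have "measure lborel (near_rational q r :: (real ^ 'n) set)
    \<le> (\<Sum>b\<in>(int_cube (2 * q + 1) :: (int ^ 'n) set). measure lborel
      (box (\<chi> j. pi * (of_int (b $ j) - r) / real q) (\<chi> j. pi * (of_int (b $ j) + r) / real q) :: (real ^ 'n) set))"
    unfolding near_rational_def by (intro measure_UNION_le finite_int_cube) auto
  also have "\<dots> = (\<Sum>b\<in>(int_cube (2 * q + 1) :: (int ^ 'n) set). (2 * pi * r / real q) ^ CARD('n))"
    by (simp only: box)
  also have "\<dots> = (real (2 * q + 1) * (2 * pi * r / real q)) ^ CARD('n)"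
    by (simp only: sum_constant card_int_cube power_mult_distrib of_nat_power)
  also have "\<dots> \<le> (6 * pi * r) ^ CARD('n)"
  proof (intro power_mono)
    have "real (2 * q + 1) * (2 * pi * r / real q) \<le> (3 * real q) * (2 * pi * r / real q)"
      using assms by (intro mult_right_mono) auto
    also have "\<dots> = 6 * pi * r" using assms by simp
    finally show "real (2 * q + 1) * (2 * pi * r / real q) \<le> 6 * pi * r" .
  qed (use assms in auto)
  finally show ?thesis .
qed

lemma near_rationalI:
  fixes x :: "real ^ 'n::finite"
  assumes x: "x \<in> period_cube" and q: "q > 0" "r \<le> 1"
    and b: "\<And>j. \<bar>real q * (x $ j / pi) - of_int (b j)\<bar> < r"
  shows "x \<in> near_rational q r"
proof -
  have "(\<chi> j. b j) \<in> int_cube (2 * q + 1)"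
    unfolding int_cube_def
  proof (intro CollectI allI)
    fix j
    have "0 \<le> x $ j" "x $ j \<le> 2 * pi" using x by (auto simp: mem_period_cube)
    hence "0 \<le> x $ j / pi" "x $ j / pi \<le> 2"
      by (simp_all add: field_simps)
    note bounds = mult_nonneg_nonneg[OF of_nat_0_le_iff this(1), of q]
      mult_left_mono[OF this(2) of_nat_0_le_iff, of q]
    \<comment> \<open>The strict inequality for \<open>b\<close> together with
      \<open>r \<le> 1\<close> confines the integer \<open>b j\<close> to
      \<open>0, ..., 2 * q\<close>, exactly the numerators in
      \<open>int_cube (2 * q + 1)\<close>.\<close>
    have "real_of_int (b j) > -1" "real_of_int (b j) < real q * 2 + 1"
      using b[of j] q bounds by linarith+
    thus "0 \<le> (\<chi> j. b j) $ j \<and> (\<chi> j. b j) $ j < int (2 * q + 1)"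
      by simp
  qed
  moreover have "x \<in> box (\<chi> j. pi * (of_int ((\<chi> j. b j) $ j) - r) / real q) (\<chi> j. pi * (of_int ((\<chi> j. b j) $ j) + r) / real q)"
    unfolding mem_box_cart
  proof (intro allI)
    fix j
    have "of_int (b j) - r < real q * (x $ j / pi)" "real q * (x $ j / pi) < of_int (b j) + r"
      using b[of j] unfolding abs_less_iff by linarith+
    thus "(\<chi> j. pi * (of_int ((\<chi> j. b j) $ j) - r) / real q) $ j < x $ j \<and>
      x $ j < (\<chi> j. pi * (of_int ((\<chi> j. b j) $ j) + r) / real q) $ j"
      using q by (simp add: field_simps)
  qed
  ultimately show ?thesis unfolding near_rational_def by blast
qed

text \<open>At time \<open>pi / (2 * q)\<close> the quadratic phase is that of
  \<open>gauss_term\<close> to modulus \<open>2 * q\<close>, and the main part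
  \<open>pi * b j / q\<close> of \<open>x $ j\<close> gives its linear phase. The remaining error is
  the perturbation \<open>\<delta>\<close>, which the conditions on \<open>r\<close> keep
  small.\<close>

lemma norm_schroedinger_flow_cube_poly_ge:
  fixes x :: "real ^ 'n::finite"
  assumes q: "q > 0" and r: "r \<le> 1 / 2" "3 * real N * r \<le> real q"
    and N: "32 * real q * harm (2 * q) \<le> real N"
    and b: "\<And>j. \<bar>real q * (x $ j / pi) - of_int (b j)\<bar> \<le> r"
  shows "(real N / (4 * sqrt (2 * real q))) ^ CARD('n)
      \<le> cmod (schroedinger_flow (pi / (2 * real q)) (cube_poly N) x)"
proof -
  have "real N / (4 * sqrt (2 * real q)) \<le> cmod (\<Sum>k<N. cis (real k * x $ j - pi / (2 * real q) * (real k)\<^sup>2))" for j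
  proof -
    define \<delta> where "\<delta> = (real q * (x $ j / pi) - of_int (b j)) / (2 * real q)"
    have le: "\<bar>\<delta>\<bar> \<le> r / (2 * real q)"
      using b[of j] q by (simp add: \<delta>_def divide_right_mono)
    have 1: "\<bar>\<delta>\<bar> \<le> 1 / (2 * real (2 * q))"
      using divide_right_mono[OF r(1), of "2 * real q"] le by simp
    have "6 * real N * \<bar>\<delta>\<bar> \<le> 6 * real N * (r / (2 * real q))"
      using le by (intro mult_left_mono) auto
    also have "\<dots> \<le> 1" using r(2) q by (simp add: field_simps)
    finally have 2: "6 * real N * \<bar>\<delta>\<bar> \<le> 1" .
    have "gauss_term (2 * q) (b j) k * cis (real k * (2 * pi * \<delta>)) = cis (real k * x $ j - pi / (2 * real q) * (real k)\<^sup>2)" for k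
      using q unfolding gauss_term_def cis_mult \<delta>_def
      by (intro arg_cong[where f = cis]) (simp add: field_simps)
    moreover have "real N / (4 * sqrt (real (2 * q))) \<le> cmod (\<Sum>k<N. gauss_term (2 * q) (b j) k * cis (real k * (2 * pi * \<delta>)))"
      using 1 2 N q by (intro norm_incomplete_gauss_sum_ge) auto
    ultimately show ?thesis by simp
  qed
  hence "(\<Prod>j\<in>(UNIV :: 'n set). real N / (4 * sqrt (2 * real q)))
     \<le> (\<Prod>j\<in>UNIV. cmod (\<Sum>k<N. cis (real k * x $ j - pi / (2 * real q) * (real k)\<^sup>2)))"
    by (intro prod_mono) auto
  thus ?thesis by (simp add: schroedinger_flow_cube_poly prod_norm[symmetric])
qed

subsection \<open>The maximal estimate\<close>

text \<open>Denominators up to \<open>M ^ d / K\<close>, with \<open>d = CARD('n)\<close>, cover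
  measure at most \<open>(6 * pi) ^ d / K\<close>, and \<open>K\<close> makes this half of the cube.
  For larger \<open>q\<close>, \<open>M = 3 * K * n\<close> yields \<open>3 * N \<le> q * M\<close>,
  the closeness needed at scale \<open>1 / N\<close>. The factor \<open>n\<close> in
  \<open>N\<close> absorbs the harmonic number.\<close>

lemma maximal_function_cube_poly_ge:
  fixes n M N :: nat
  defines "K \<equiv> 2 * 3 ^ CARD('n::finite)"
  defines "M \<equiv> 3 * K * n" and "N \<equiv> n * M ^ CARD('n)"
  assumes n: "n > 0" "32 * harm (2 * M ^ CARD('n)) \<le> real n"
  shows "(real N / (4 * sqrt (2 * real M ^ CARD('n)))) ^ CARD('n) * sqrt ((2 * pi) ^ CARD('n) / 2)
     \<le> torus_L2_norm (\<lambda>x :: real ^ 'n. SUP t\<in>{0..1}. cmod (schroedinger_flow t (cube_poly N) x))"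
proof -
  let ?d = "CARD('n)"
  let ?u = "\<lambda>t (x :: real ^ 'n). cmod (schroedinger_flow t (cube_poly N) x)"
  let ?F = "\<lambda>x. SUP t\<in>{0..1}. ?u t x"
  define A where "A = (real N / (4 * sqrt (2 * real M ^ ?d))) ^ ?d"
  define Q where "Q = M ^ ?d div K"
  define r where "r = 1 / real M"
  define Z :: "(real ^ 'n) set" where "Z = (\<Union>q\<in>{1..Q}. near_rational q r)"
  have K: "K > 0" and M: "M \<ge> 2" using n by (auto simp: K_def M_def)
  have r: "0 < r" "r \<le> 1 / 2" using M by (auto simp: r_def field_simps)
  \<comment> \<open>The trivial bound serves twice: it makes the supremum over times meaningful and
    the maximal function square integrable.\<close>
  have ub: "?u t x \<le> real N ^ ?d" for t x
  proof -
    have "?u t x = (\<Prod>j\<in>UNIV. cmod (\<Sum>k<N. cis (real k * x $ j - t * (real k)\<^sup>2)))"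
      by (simp add: schroedinger_flow_cube_poly prod_norm)
    also have "\<dots> \<le> (\<Prod>j\<in>(UNIV :: 'n set). real N)"
      by (intro prod_mono conjI norm_ge_zero order_trans[OF norm_sum]) simp
    finally show ?thesis by simp
  qed
  have bdd: "bdd_above ((\<lambda>t. ?u t x) ` {0..1})" for x
    using ub by (auto intro!: bdd_aboveI)
  have meas: "?F \<in> borel_measurable borel"
    using bdd unfolding schroedinger_flow_cube_poly
    by (intro borel_measurable_SUP_continuous continuous_intros) auto
  have F_ge: "?u t x \<le> ?F x" if "t \<in> {0..1}" for t x
    by (rule cSUP_upper[OF that bdd])
  have F_bound: "\<bar>?F x\<bar> \<le> real N ^ ?d" for x
  proof -
    have "0 \<le> ?F x" using F_ge[of 0 x] norm_ge_zero order_trans by (metis atLeastAtMost_iff order_refl zero_le_one)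
    moreover have "?F x \<le> real N ^ ?d" by (intro cSUP_least ub) auto
    ultimately show ?thesis by simp
  qed
  have Z_borel: "Z \<in> sets borel"
    unfolding Z_def by (intro sets.finite_UN near_rational_borel) auto
  have cube_borel: "(period_cube :: (real ^ 'n) set) \<in> sets borel"
    by (simp add: period_cube_def)
  have large: "A \<le> ?F x" if x: "x \<in> period_cube - Z" for x
  proof -
    obtain q b where q: "0 < q" "q \<le> M ^ ?d"
      and b: "\<And>j. \<bar>real q * (x $ j / pi) - of_int (b j)\<bar> < 1 / real M"
      using Dirichlet_approx_simult_cart[of M "\<lambda>j. x $ j / pi"] M by auto
    have "q > Q"
    proof (rule ccontr)
      assume "\<not> q > Q"
      moreover have "x \<in> near_rational q r"
        using x q b r by (intro near_rationalI) (auto simp: r_def)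
      ultimately show False using x q by (auto simp: Z_def)
    qed
    hence qK: "M ^ ?d < q * K"
      using K by (simp add: Q_def div_less_iff_less_mult)
    \<comment> \<open>This makes \<open>q\<close> exceed \<open>3 * n\<close>, so that the time
      \<open>pi / (2 * q)\<close> lies in the unit interval.\<close>
    have "M ^ 1 \<le> M ^ ?d" using M by (intro power_increasing) (auto simp: Suc_le_eq)
    hence "M < q * K" using qK by simp
    hence "(3 * n) * K < q * K" by (simp only: M_def mult_ac)
    hence q3: "3 * n < q" by (rule mult_right_less_imp_less) simp
    have "pi / (2 * real q) \<le> 1"
      using q3 n pi_less_4 by (simp add: field_simps)
    hence t: "pi / (2 * real q) \<in> {0..1}" by simp
    have "3 * n * M ^ ?d \<le> 3 * n * (q * K)" using qK by (intro mult_left_mono) auto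
    hence "3 * N \<le> q * M" by (simp add: N_def M_def mult_ac)
    hence "3 * real N \<le> real q * real M" by (metis of_nat_mult of_nat_le_iff of_nat_numeral)
    hence 1: "3 * real N * r \<le> real q" using M by (simp add: r_def field_simps)
    have "32 * real q * harm (2 * q) = real q * (32 * harm (2 * q))" by simp
    also have "\<dots> \<le> real q * (32 * harm (2 * M ^ ?d))"
      using q by (intro mult_left_mono harm_mono) auto
    also have "\<dots> \<le> real q * real n" using n by (intro mult_left_mono) auto
    also have "\<dots> \<le> real (M ^ ?d) * real n" using q by (intro mult_right_mono) linarith+
    finally have 2: "32 * real q * harm (2 * q) \<le> real N" by (simp add: N_def mult_ac)
    have "real q \<le> real M ^ ?d" using q(2) by (simp flip: of_nat_power)
    hence "A \<le> (real N / (4 * sqrt (2 * real q))) ^ ?d"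
      using q M unfolding A_def by (intro power_mono divide_left_mono) auto
    also have "\<dots> \<le> ?u (pi / (2 * real q)) x"
      using b by (intro norm_schroedinger_flow_cube_poly_ge[OF q(1) r(2) 1 2, of _ b]) (simp add: r_def less_imp_le)
    also have "\<dots> \<le> ?F x" by (rule F_ge[OF t])
    finally show ?thesis .
  qed
  have "measure lborel Z \<le> (\<Sum>q\<in>{1..Q}. measure lborel (near_rational q r :: (real ^ 'n) set))"
    unfolding Z_def by (intro measure_UNION_le) (auto simp: near_rational_borel)
  also have "\<dots> \<le> (\<Sum>q\<in>{1..Q}. (6 * pi * r) ^ ?d)"
    using r by (intro sum_mono measure_near_rational_le) auto
  also have "\<dots> = real Q * (6 * pi * r) ^ ?d" by simp
  also have "\<dots> \<le> (real M ^ ?d / real K) * (6 * pi * r) ^ ?d"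
  proof (intro mult_right_mono)
    have "real Q * real K \<le> real M ^ ?d"
      unfolding Q_def by (metis div_times_less_eq_dividend of_nat_le_iff of_nat_mult of_nat_power)
    thus "real Q \<le> real M ^ ?d / real K" using K by (simp add: field_simps)
  qed (use r in auto)
  also have "\<dots> = (real M * (6 * pi * r)) ^ ?d / real K"
    by (simp add: power_mult_distrib)
  also have "real M * (6 * pi * r) = 3 * (2 * pi)"
    using M by (simp add: r_def)
  also have "(3 * (2 * pi)) ^ ?d / real K = (2 * pi) ^ ?d / 2"
    using power_mult_distrib[of "2 :: real" 3 ?d] by (simp add: K_def power_mult_distrib)
  finally have measZ: "measure lborel Z \<le> (2 * pi) ^ ?d / 2" .
  have cube: "measure lborel (period_cube :: (real ^ 'n) set) = (2 * pi) ^ ?d"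
  proof -
    have "measure lborel (period_cube :: (real ^ 'n) set) = measure lborel (box 0 (\<chi> j. 2 * pi) :: (real ^ 'n) set)"
      unfolding period_cube_def by (simp add: measure_def emeasure_lborel_cbox_eq emeasure_lborel_box_eq)
    thus ?thesis by (simp add: measure_lborel_box_cart)
  qed
  have "measure lborel (period_cube :: (real ^ 'n) set) \<le> measure lborel (Z \<union> (period_cube - Z))"
  proof (rule measure_mono_fmeasurable)
    show "Z \<union> (period_cube - Z) \<in> fmeasurable lborel"
    proof -
      have "near_rational q r \<in> fmeasurable lborel" for q :: nat
        unfolding near_rational_def by (intro fmeasurable.finite_UN finite_int_cube) auto
      hence "Z \<in> fmeasurable lborel" unfolding Z_def by (intro fmeasurable.finite_UN) auto
      moreover have "(period_cube :: (real ^ 'n) set) \<in> fmeasurable lborel" by (simp add: period_cube_def)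
      ultimately have "Z \<union> period_cube \<in> fmeasurable lborel" by (rule fmeasurable.Un)
      thus ?thesis by simp
    qed
  qed (use cube_borel in auto)
  also have "\<dots> \<le> measure lborel Z + measure lborel (period_cube - Z)"
    using Z_borel cube_borel by (intro measure_Un_le) auto
  finally have "(2 * pi) ^ ?d / 2 \<le> measure lborel (period_cube - Z)"
    using measZ cube by simp
  hence "A * sqrt ((2 * pi) ^ ?d / 2) \<le> A * sqrt (measure lborel (period_cube - Z))"
    by (intro mult_left_mono real_sqrt_le_mono) (auto simp: A_def)
  also have "\<dots> \<le> torus_L2_norm ?F"
    using meas Z_borel cube_borel large F_bound by (intro torus_L2_norm_ge) (auto simp: A_def)
  finally show ?thesis unfolding A_def .
qed

text \<open>Since \<open>harm m - ln m\<close> decreases from its value 1 at \<open>m = 1\<close>, a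
  harmonic number of polynomially large index is \<open>O(ln n)\<close>, hence eventually below any
  fixed multiple of \<open>n\<close>.\<close>

lemma eventually_harm_power_le:
  fixes c d :: nat and B :: real
  assumes "c > 0" "B > 0"
  shows "eventually (\<lambda>n. B * harm (2 * (c * n) ^ d) \<le> real n) sequentially"
proof -
  have bound: "harm (2 * (c * n) ^ d) \<le> 1 + ln 2 + real d * ln (real c) + real d * ln (real n)" if "n > 0" for n
  proof -
    define m where "m = 2 * (c * n) ^ d"
    have "m > 0" using that assms by (simp add: m_def)
    have "harm m - ln (real m) \<le> harm (1::nat) - ln (real 1)"
      using \<open>m > 0\<close> by (intro euler_mascheroni_sequence_decreasing) auto
    hence "harm m \<le> 1 + ln (real m)" by (simp add: harm_def)
    also have "ln (real m) = ln 2 + real d * (ln (real c) + ln (real n))"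
      using that assms by (simp add: m_def ln_mult ln_realpow)
    finally show ?thesis by (simp add: m_def algebra_simps)
  qed
  define a where "a = 1 + ln 2 + real d * ln (real c)"
  have "(\<lambda>n. B * a / real n + B * real d * (ln (real n) / real n)) \<longlonglongrightarrow> 0 + B * real d * 0"
    by (intro tendsto_add tendsto_mult tendsto_const lim_const_over_n lim_ln_over_n)
  hence "eventually (\<lambda>n. B * a / real n + B * real d * (ln (real n) / real n) < 1) sequentially"
    by (intro order_tendstoD) auto
  thus ?thesis using eventually_gt_at_top[of 0]
  proof eventually_elim
    case (elim n)
    have "B * harm (2 * (c * n) ^ d) \<le> B * (a + real d * ln (real n))"
      using bound[OF elim(2)] assms by (intro mult_left_mono) (auto simp: a_def)
    also have "\<dots> \<le> real n" using elim by (simp add: field_simps)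
    finally show ?case .
  qed
qed

theorem proposition3p2:
  fixes s :: real
  assumes "s < real CARD('n::finite) / (2 * (real CARD('n) + 1))"
  shows "\<not> (\<exists>C::real. \<forall>f :: real ^ 'n \<Rightarrow> complex. trig_polynomial f \<longrightarrow>
           torus_L2_norm (\<lambda>x. SUP t\<in>{0..1}. cmod (schroedinger_flow t f x))
             \<le> C * sobolev_norm s f)"
proof
  let ?d = "CARD('n)"
  assume "\<exists>C::real. \<forall>f :: real ^ 'n \<Rightarrow> complex. trig_polynomial f \<longrightarrow>
           torus_L2_norm (\<lambda>x. SUP t\<in>{0..1}. cmod (schroedinger_flow t f x)) \<le> C * sobolev_norm s f"
  then obtain C where C: "\<And>f :: real ^ 'n \<Rightarrow> complex. trig_polynomial f \<Longrightarrow>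
      torus_L2_norm (\<lambda>x. SUP t\<in>{0..1}. cmod (schroedinger_flow t f x)) \<le> C * sobolev_norm s f"
    by blast
  \<comment> \<open>Truncating at 0 keeps the exponent below the threshold, which is
    positive.\<close>
  define \<sigma> where "\<sigma> = max s 0"
  have \<sigma>: "s \<le> \<sigma>" "0 \<le> \<sigma>" by (auto simp: \<sigma>_def)
  have d: "real ?d > 0" by simp
  have "\<sigma> < real ?d / (2 * (real ?d + 1))" using assms d by (auto simp: \<sigma>_def)
  hence \<epsilon>: "0 < real ?d - 2 * (real ?d + 1) * \<sigma>" using d by (simp add: field_simps)
  \<comment> \<open>This is \<open>3 * K\<close> of the previous construction, so that
    \<open>M = c * n\<close> and \<open>N = c ^ d * n ^ (d + 1)\<close>.\<close>
  define c where "c = 3 * (2 * 3 ^ ?d :: nat)"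
  define D where "D = 2 * real ?d * (real c ^ ?d)\<^sup>2"
  define E where "E = 2 * (32 / (2 * pi)) ^ ?d * (C\<^sup>2 * D powr \<sigma>)"
  have c: "c > 0" by (simp add: c_def)
  \<comment> \<open>Testing the estimate on \<open>cube_poly N\<close> forces
    \<open>n ^ d \<le> E * n powr (2 * (d + 1) * \<sigma>)\<close>; below the threshold the exponent
    on the right is smaller than \<open>d\<close>.\<close>
  have "eventually (\<lambda>n. 1 \<le> E * real n powr (2 * (real ?d + 1) * \<sigma> - real ?d)) sequentially"
    using eventually_harm_power_le[where B = 32 and d = ?d, OF c zero_less_numeral] eventually_gt_at_top[of 0]
  proof eventually_elim
    case (elim n)
    define N where "N = n * (c * n) ^ ?d"
    define a where "a = (2 * pi) ^ ?d / 2"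
    let ?A = "(real N / (4 * sqrt (2 * real (c * n) ^ ?d))) ^ ?d"
    let ?T = "1 + real ?d * (real N)\<^sup>2"
    have N: "real N > 0" "real N = real c ^ ?d * real n ^ (?d + 1)"
      using elim c by (auto simp: N_def power_mult_distrib)
    have "0 \<le> a" by (simp add: a_def)
    have "?A * sqrt a \<le> C * sobolev_norm s (cube_poly N :: real ^ 'n \<Rightarrow> complex)"
      using maximal_function_cube_poly_ge[where 'n = 'n, of n] elim C[OF trig_polynomial_cube_poly, of N]
      by (simp add: c_def N_def a_def)
    \<comment> \<open>The sign of \<open>C\<close> is unknown, and both sides are to be
      squared.\<close>
    also have "\<dots> \<le> \<bar>C\<bar> * sobolev_norm s (cube_poly N :: real ^ 'n \<Rightarrow> complex)"
      by (intro mult_right_mono) (auto simp: sobolev_norm_def intro!: infsum_nonneg)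
    also have "\<dots> \<le> \<bar>C\<bar> * sqrt (real N ^ ?d * ?T powr \<sigma>)"
      by (intro mult_left_mono sobolev_norm_cube_poly_le \<sigma>) auto
    finally have "(?A * sqrt a)\<^sup>2 \<le> (\<bar>C\<bar> * sqrt (real N ^ ?d * ?T powr \<sigma>))\<^sup>2"
      using \<open>0 \<le> a\<close> by (intro power_mono) auto
    hence "?A\<^sup>2 * a \<le> C\<^sup>2 * (real N ^ ?d * ?T powr \<sigma>)"
      using \<open>0 \<le> a\<close> N by (simp add: power_mult_distrib)
    also have "?A\<^sup>2 = ((real N / (4 * sqrt (2 * real (c * n) ^ ?d)))\<^sup>2) ^ ?d"
      by (simp only: power_mult[symmetric] mult.commute)
    \<comment> \<open>With \<open>N = n * (c * n) ^ d\<close>, the square splits off one factor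
      \<open>N\<close> per coordinate. The resulting \<open>N ^ d\<close> is the squared
      \<open>L2\<close> size of the polynomial up to a constant and cancels against the Sobolev
      side.\<close>
    also have "(real N / (4 * sqrt (2 * real (c * n) ^ ?d)))\<^sup>2 = real N * (real n / 32)"
      using elim c by (simp add: power_divide power_mult_distrib N_def) (simp add: field_simps power2_eq_square)
    finally have "real N ^ ?d * ((real n / 32) ^ ?d * a) \<le> real N ^ ?d * (C\<^sup>2 * ?T powr \<sigma>)"
      by (simp only: power_mult_distrib mult_ac)
    hence "(real n / 32) ^ ?d * a \<le> C\<^sup>2 * ?T powr \<sigma>"
      using N by simp
    also have "\<dots> \<le> C\<^sup>2 * (D * real n powr (2 * (real ?d + 1))) powr \<sigma>"
    proof (intro mult_left_mono powr_mono2 \<sigma>)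
      have "N \<ge> 1" using N by linarith
      hence "1 \<le> real ?d * (real N)\<^sup>2" using d
        by (metis One_nat_def Suc_leI mult_le_mono nat_mult_1 of_nat_0_less_iff of_nat_1 of_nat_le_iff of_nat_mult of_nat_power one_le_power)
      hence "?T \<le> 2 * real ?d * (real N)\<^sup>2" by simp
      also have "\<dots> = D * (real n ^ (?d + 1))\<^sup>2"
        unfolding N(2) D_def by (simp add: power_mult_distrib)
      also have "(real n ^ (?d + 1))\<^sup>2 = real n ^ (2 * (?d + 1))"
        by (simp only: power_mult[symmetric] mult.commute)
      also have "\<dots> = real n powr real (2 * (?d + 1))"
        using elim by (intro powr_realpow[symmetric]) simp
      also have "real (2 * (?d + 1)) = 2 * (real ?d + 1)" by simp
      finally show "?T \<le> D * real n powr (2 * (real ?d + 1))" .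
    qed auto
    also have "\<dots> = C\<^sup>2 * D powr \<sigma> * real n powr (2 * (real ?d + 1) * \<sigma>)"
      by (simp add: powr_mult powr_powr D_def)
    finally have *: "(real n / 32) ^ ?d * a \<le> C\<^sup>2 * D powr \<sigma> * real n powr (2 * (real ?d + 1) * \<sigma>)" .
    have "real n ^ ?d = (real n / 32) ^ ?d * a * (2 * (32 / (2 * pi)) ^ ?d)"
      using power_mult_distrib[of "2 :: real" 16 ?d] by (simp add: a_def power_divide power_mult_distrib)
    also have "\<dots> \<le> C\<^sup>2 * D powr \<sigma> * real n powr (2 * (real ?d + 1) * \<sigma>) * (2 * (32 / (2 * pi)) ^ ?d)"
      using * by (intro mult_right_mono) auto
    also have "\<dots> = E * real n powr (2 * (real ?d + 1) * \<sigma>)"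
      by (simp add: E_def mult_ac)
    finally show ?case
      using elim by (simp add: powr_diff powr_realpow field_simps)
  qed
  \<comment> \<open>By \<open>\<epsilon>\<close> the exponent is negative, so the right-hand side
    tends to 0 and cannot stay above 1.\<close>
  moreover have "(\<lambda>n. E * real n powr (2 * (real ?d + 1) * \<sigma> - real ?d)) \<longlonglongrightarrow> E * 0"
    using \<epsilon> by (intro tendsto_mult tendsto_const tendsto_neg_powr filterlim_real_sequentially) auto
  hence "eventually (\<lambda>n. E * real n powr (2 * (real ?d + 1) * \<sigma> - real ?d) < 1) sequentially"
    by (rule order_tendstoD) simp
  ultimately have "eventually (\<lambda>n::nat. False) sequentially"
    by eventually_elim simp
  thus False by simp
qed

end
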